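(* Let $I=[a,b]\subset\mathbb{R}$ with $a<b$, and let $f:I\to\mathbb{R}$ be continuous. For any $\epsilon>0$ there exists a Lipschitz continuous function $g_\epsilon:I\to\mathbb{R}$ such that $|g_\epsilon|_{\mathrm{Lip}(I)}<\epsilon$ and, for every $y\in\mathbb{R}$, $$\mu(\{x\in I: f(x)+g_\epsilon(x)=y\})=0.$$
   Context: $\mu$ denotes Lebesgue measure on $\mathbb{R}$. For $g:I\to\mathbb{R}$, the Lipschitz seminorm is $|g|_{\mathrm{Lip}(I)}:=\sup_{x,y\in I,\,x\neq y}\frac{|g(x)-g(y)|}{|x-y|}$, and $g$ is Lipschitz continuous on $I$ if $|g|_{\mathrm{Lip}(I)}<\infty$. *)

theory Defs
  imports "HOL-Analysis.Analysis"
begin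

(* The supremum is taken in [0, \<infinity>]: a supremum of reals would be unspecified for an
   unbounded set of difference quotients. If S has at most one point, the value is 0. *)
definition lip_seminorm :: "real set \<Rightarrow> (real \<Rightarrow> real) \<Rightarrow> ennreal" where
  "lip_seminorm S g =
     (SUP (x, y) \<in> {(x, y). x \<in> S \<and> y \<in> S \<and> x \<noteq> y}. ennreal (\<bar>g x - g y\<bar> / \<bar>x - y\<bar>))"

definition lip_continuous_on :: "real set \<Rightarrow> (real \<Rightarrow> real) \<Rightarrow> bool" where
  "lip_continuous_on S g \<longleftrightarrow> lip_seminorm S g < \<infinity>"

end

theory Submission
  imports Defs
begin

text \<open>
  A linear perturbation \<open>g x = c * x\<close> with \<open>0 < c < \<epsilon>\<close> works for all but countably many \<open>c\<close>.
  Call \<open>c\<close> bad if \<open>A c = {x \<in> {a..b}. f x + c * x = y c}\<close> has positive measure for some choice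
  of the level \<open>y c\<close>. Over \<open>A c\<close> the graph of \<open>f\<close> lies on a line of slope \<open>-c\<close>, and two lines
  of different slopes meet in at most one point, so \<open>A c\<close> and \<open>A d\<close> share at most one point when
  \<open>c \<noteq> d\<close> (\<open>level_sets_different_slopes_overlap\<close>). A set of finite measure has room for only
  countably many almost disjoint sets of positive measure
  (\<open>countable_nonnull_of_almost_disjoint\<close>), whereas \<open>(0, \<epsilon>)\<close> is uncountable, so it contains a
  slope that is not bad.
\<close>

text \<open>
  The measures of finitely many members of the family add up to the measure of their union, hence
  to at most the measure of \<open>B\<close>. So the whole family of measures is summable, and a summable
  family of reals has countable support.
\<close>
lemma countable_nonnull_of_almost_disjoint:
  fixes A :: "'i \<Rightarrow> 'a::euclidean_space set"
  assumes B: "B \<in> lmeasurable"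
    and A: "\<And>i. i \<in> I \<Longrightarrow> A i \<in> sets lebesgue" "\<And>i. i \<in> I \<Longrightarrow> A i \<subseteq> B"
    and overlap: "\<And>i j. i \<in> I \<Longrightarrow> j \<in> I \<Longrightarrow> i \<noteq> j \<Longrightarrow> negligible (A i \<inter> A j)"
  shows "countable {i \<in> I. measure lebesgue (A i) \<noteq> 0}"
proof (rule summable_countable_real, rule nonneg_bdd_above_summable_on)
  show "bdd_above (sum (\<lambda>i. measure lebesgue (A i)) ` {F. F \<subseteq> I \<and> finite F})"
  proof (rule bdd_aboveI2)
    fix F assume "F \<in> {F. F \<subseteq> I \<and> finite F}"
    then have F: "F \<subseteq> I" "finite F" by auto
    have lm: "A i \<in> lmeasurable" if "i \<in> F" for i
      using fmeasurableI2[OF B] A F that by blast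
    have pw: "pairwise (\<lambda>i j. negligible (A i \<inter> A j)) F"
      using F(1) by (intro pairwiseI overlap) blast+
    have "(\<Sum>i\<in>F. measure lebesgue (A i)) = measure lebesgue (\<Union>i\<in>F. A i)"
      using measure_negligible_finite_Union_image[OF F(2) lm pw] by simp
    also have "\<dots> \<le> measure lebesgue B"
    proof (rule measure_mono_fmeasurable[OF _ _ B])
      show "(\<Union>i\<in>F. A i) \<subseteq> B" using A F by blast
      show "(\<Union>i\<in>F. A i) \<in> sets lebesgue" using A F by blast
    qed
    finally show "(\<Sum>i\<in>F. measure lebesgue (A i)) \<le> measure lebesgue B" .
  qed
qed simp

lemma level_set_linear_perturbation_lmeasurable:
  fixes f :: "real \<Rightarrow> real"
  assumes "continuous_on {a..b} f"
  shows "{x \<in> {a..b}. f x + c * x = y} \<in> lmeasurable"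
proof -
  have "continuous_on {a..b} (\<lambda>x. f x + c * x)"
    by (intro continuous_intros assms)
  from continuous_closed_preimage_constant[OF this, of y]
  have "closed {x \<in> {a..b}. f x + c * x = y}" by simp
  moreover have "bounded {x \<in> {a..b}. f x + c * x = y}"
    by (rule bounded_subset[of "{a..b}"]) auto
  ultimately show ?thesis
    by (intro lmeasurable_compact) (simp add: compact_eq_bounded_closed)
qed

lemma level_sets_different_slopes_overlap:
  fixes f :: "real \<Rightarrow> real"
  assumes "c \<noteq> d"
  shows "{x \<in> S. f x + c * x = y} \<inter> {x \<in> S. f x + d * x = z} \<subseteq> {(y - z) / (c - d)}"
  using assms by (auto simp: field_simps)

lemma countable_slopes_with_nonnull_level_set:
  fixes f :: "real \<Rightarrow> real"
  assumes f: "continuous_on {a..b} f"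
  shows "countable {c. \<exists>y. measure lebesgue {x \<in> {a..b}. f x + c * x = y} \<noteq> 0}"
    (is "countable ?C")
proof -
  have "\<forall>c\<in>?C. \<exists>y. measure lebesgue {x \<in> {a..b}. f x + c * x = y} \<noteq> 0" by blast
  from bchoice[OF this] obtain y
    where y: "\<And>c. c \<in> ?C \<Longrightarrow> measure lebesgue {x \<in> {a..b}. f x + c * x = y c} \<noteq> 0"
    by blast
  define A where "A c = {x \<in> {a..b}. f x + c * x = y c}" for c
  have "countable {c \<in> ?C. measure lebesgue (A c) \<noteq> 0}"
  proof (rule countable_nonnull_of_almost_disjoint)
    show "{a..b} \<in> lmeasurable" by simp
    show "A c \<in> sets lebesgue" for c
      using level_set_linear_perturbation_lmeasurable[OF f] by (simp add: A_def fmeasurableD)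
    show "A c \<subseteq> {a..b}" for c by (auto simp: A_def)
    show "negligible (A c \<inter> A d)" if "c \<noteq> d" for c d
      unfolding A_def
      using level_sets_different_slopes_overlap[OF that]
      by (rule negligible_subset[rotated]) simp
  qed
  moreover have "{c \<in> ?C. measure lebesgue (A c) \<noteq> 0} = ?C"
    using y unfolding A_def by blast
  ultimately show ?thesis by simp
qed

lemma lip_seminorm_linear_le:
  assumes "c \<ge> 0"
  shows "lip_seminorm S (\<lambda>x. c * x) \<le> ennreal c"
  unfolding lip_seminorm_def
proof (rule SUP_least, clarify)
  fix x y :: real assume "x \<noteq> y"
  then have "\<bar>c * x - c * y\<bar> / \<bar>x - y\<bar> = c"
    using assms by (simp add: abs_mult flip: right_diff_distrib)
  then show "ennreal (\<bar>c * x - c * y\<bar> / \<bar>x - y\<bar>) \<le> ennreal c" by simp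
qed

theorem theorem1p1:
  fixes a b \<epsilon> :: real and f :: "real \<Rightarrow> real"
  assumes "a < b"
    and "continuous_on {a..b} f"
    and "\<epsilon> > 0"
  shows "\<exists>g :: real \<Rightarrow> real. lip_continuous_on {a..b} g \<and>
           lip_seminorm {a..b} g < ennreal \<epsilon> \<and>
           (\<forall>y :: real. emeasure lebesgue {x \<in> {a..b}. f x + g x = y} = 0)"
proof -
  have "uncountable {0<..<\<epsilon>}"
    using assms(3) by (simp add: uncountable_open_interval)
  then have "\<not> {0<..<\<epsilon>} \<subseteq> {c. \<exists>y. measure lebesgue {x \<in> {a..b}. f x + c * x = y} \<noteq> 0}"
    using countable_subset countable_slopes_with_nonnull_level_set[OF assms(2)] by blast
  then obtain c where "c \<in> {0<..<\<epsilon>}"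
    and null: "\<And>y. measure lebesgue {x \<in> {a..b}. f x + c * x = y} = 0"
    by blast
  then have c: "0 < c" "c < \<epsilon>" by simp_all
  have small: "lip_seminorm {a..b} (\<lambda>x. c * x) < ennreal \<epsilon>"
    using lip_seminorm_linear_le[of c "{a..b}"] c
    by (auto intro: le_less_trans simp: ennreal_less_iff)
  then have "lip_continuous_on {a..b} (\<lambda>x. c * x)"
    unfolding lip_continuous_on_def by (rule less_trans) simp
  moreover have "emeasure lebesgue {x \<in> {a..b}. f x + c * x = y} = 0" for y
    using emeasure_eq_measure2[OF level_set_linear_perturbation_lmeasurable[OF assms(2)]] null
    by simp
  ultimately show ?thesis using small by blast
qed

end
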